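(* Let $D$ be an integral domain with quotient field $K$ and let $E$ be a nonempty subset of $K$. Let $(\mathcal P)$ denote one of the following properties of integral domains: Krull, Mori, almost Krull, or locally Mori. If $\mathrm{Int}^{\mathrm R}(E,D)$ has the property $(\mathcal P)$, then $D$ has the same property $(\mathcal P)$.
   Context: $\mathrm{Int}^{\mathrm R}(E,D):=\{f\in K(X);\ f(E)\subseteq D\}$, where $f(E)\subseteq D$ means that for every $e\in E$ the rational function $f$ is defined at $e$ and $f(e)\in D$. For an integral domain $R$ with quotient field $F$ and a nonzero fractional ideal $I$ of $R$, $I^{-1}:=\{x\in F;\ xI\subseteq R\}$ and $I_v:=(I^{-1})^{-1}$; a nonzero ideal $I$ of $R$ is a $v$-ideal (divisorial) if $I_v=I$. $R$ is a Mori domain if it satisfies the ascending chain condition on $v$-ideals of $R$. $R$ is locally Mori (resp., almost Krull) if every localization of $R$ at a maximal ideal is a Mori (resp., a Krull) domain. Fields are considered Krull (and Mori) domains. *)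

theory Defs
  imports
    "HOL-Algebra.Subrings"
    "HOL-Algebra.Ideal"
    "HOL-Algebra.Algebraic_Closure_Type"
    "HOL-Computational_Algebra.Polynomial"
    "HOL-Computational_Algebra.Fraction_Field"
begin

text \<open>
  Integral domains are represented as subrings of a field type; the ambient field may be
  strictly larger than the quotient field of the domain.
\<close>

definition ring_on :: "'a::field set \<Rightarrow> 'a ring" where
  "ring_on R = ring_of_type_algebra\<lparr>carrier := R\<rparr>"

definition domain_in :: "'a::field set \<Rightarrow> bool" where
  "domain_in R \<longleftrightarrow> subdomain R (ring_of_type_algebra :: 'a ring)"

definition quotient_field :: "'a::field set \<Rightarrow> 'a set" where
  "quotient_field R = {a / b | a b. a \<in> R \<and> b \<in> R \<and> b \<noteq> 0}"

definition localization :: "'a::field set \<Rightarrow> 'a set \<Rightarrow> 'a set" where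
  "localization R M = {a / b | a b. a \<in> R \<and> b \<in> R - M}"


definition ideal_inverse :: "'a::field set \<Rightarrow> 'a set \<Rightarrow> 'a set" where
  "ideal_inverse R I = {x \<in> quotient_field R. \<forall>y\<in>I. x * y \<in> R}"

definition v_closure :: "'a::field set \<Rightarrow> 'a set \<Rightarrow> 'a set" where
  "v_closure R I = ideal_inverse R (ideal_inverse R I)"

definition v_ideal :: "'a::field set \<Rightarrow> 'a set \<Rightarrow> bool" where
  "v_ideal R I \<longleftrightarrow> ideal I (ring_on R) \<and> I \<noteq> {0} \<and> v_closure R I = I"

definition mori :: "'a::field set \<Rightarrow> bool" where
  "mori R \<longleftrightarrow> domain_in R \<and>
     (\<forall>I :: nat \<Rightarrow> 'a set. (\<forall>n. v_ideal R (I n)) \<and> (\<forall>n. I n \<subseteq> I (Suc n))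
        \<longrightarrow> (\<exists>N. \<forall>n\<ge>N. I n = I N))"


text \<open>
  Normalised discrete valuations (value group the integers) on a subfield \<open>F\<close> of the ambient
  field. The value of such a function at \<open>0\<close> and outside \<open>F\<close> is irrelevant.
\<close>

definition discrete_valuation_on :: "'a::field set \<Rightarrow> ('a \<Rightarrow> int) \<Rightarrow> bool" where
  "discrete_valuation_on F v \<longleftrightarrow>
     v ` (F - {0}) = UNIV \<and>
     (\<forall>x\<in>F - {0}. \<forall>y\<in>F - {0}. v (x * y) = v x + v y) \<and>
     (\<forall>x\<in>F - {0}. \<forall>y\<in>F - {0}. x + y \<noteq> 0 \<longrightarrow> min (v x) (v y) \<le> v (x + y))"

definition valuation_ring_on :: "'a::field set \<Rightarrow> ('a \<Rightarrow> int) \<Rightarrow> 'a set" where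
  "valuation_ring_on F v = {x \<in> F. x = 0 \<or> 0 \<le> v x}"

text \<open>
  A Krull domain is the intersection, inside its quotient field, of a family of discrete
  valuation rings of finite character. The family may be empty, so that fields are Krull.
\<close>

definition krull :: "'a::field set \<Rightarrow> bool" where
  "krull R \<longleftrightarrow> domain_in R \<and>
     (\<exists>V. (\<forall>v\<in>V. discrete_valuation_on (quotient_field R) v) \<and>
          R = {x \<in> quotient_field R. \<forall>v\<in>V. x \<in> valuation_ring_on (quotient_field R) v} \<and>
          (\<forall>x\<in>quotient_field R - {0}. finite {v \<in> V. v x \<noteq> 0}))"

definition locally_mori :: "'a::field set \<Rightarrow> bool" where
  "locally_mori R \<longleftrightarrow> domain_in R \<and>
     (\<forall>M. maximalideal M (ring_on R) \<longrightarrow> mori (localization R M))"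

definition almost_krull :: "'a::field set \<Rightarrow> bool" where
  "almost_krull R \<longleftrightarrow> domain_in R \<and>
     (\<forall>M. maximalideal M (ring_on R) \<longrightarrow> krull (localization R M))"


text \<open>
  \<open>K(X)\<close> is the type \<open>'a poly fract\<close>. A rational function is defined at \<open>e\<close> if some
  representation \<open>p / q\<close> has \<open>q(e) \<noteq> 0\<close>; the value \<open>p(e) / q(e)\<close> does not depend on which such
  representation is chosen.
\<close>

definition int_rat :: "'a::field set \<Rightarrow> 'a set \<Rightarrow> 'a poly fract set" where
  "int_rat E D =
     {f. \<forall>e\<in>E. \<exists>p q. f = Fract p q \<and> poly q e \<noteq> 0 \<and> poly p e / poly q e \<in> D}"

end

theory Submission
  imports Defs
begin

text \<open>
  Constants embed \<open>K\<close> into \<open>K(X)\<close>; since \<open>E\<close> is nonempty, \<open>D\<close> is the preimage of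
  \<open>R = Int\<^sup>R(E, D)\<close> under this embedding, that is, \<open>D = R \<inter> K\<close>. Both the Krull and the Mori
  property descend from any domain \<open>R\<close> to its intersection with a subfield \<open>K\<close>, provided that
  \<open>K\<close> is the quotient field of the intersection.
  For Krull domains, the defining valuations are restricted to \<open>K\<close>, the trivial ones among the
  restrictions are dropped and the others are renormalised (\<open>krull_vimage\<close>). For Mori domains, a
  chain of \<open>v\<close>-ideals \<open>I\<close> of \<open>R \<inter> K\<close> is sent to the chain of the \<open>v\<close>-ideals \<open>(I R)\<^sub>v\<close> of \<open>R\<close>,
  and \<open>I\<close> is recovered as \<open>(I R)\<^sub>v \<inter> K\<close> (\<open>mori_vimage\<close>).

  For the two local properties, evaluation at a point \<open>e\<close> of \<open>E\<close> is a retraction \<open>R \<rightarrow> D\<close> of the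
  inclusion of constants. So a maximal ideal \<open>M\<close> of \<open>D\<close> has a maximal preimage
  \<open>N = {f \<in> R. f(e) \<in> M}\<close>, and \<open>R\<^sub>N \<inter> K = D\<^sub>M\<close> because a constant \<open>c = f / g\<close> with \<open>g \<notin> N\<close> equals
  \<open>f(e) / g(e)\<close> (\<open>maximalideal_retraction\<close>, \<open>localization_retraction\<close>). Hence the descent
  results apply to \<open>R\<^sub>N\<close> and \<open>D\<^sub>M\<close>.
\<close>


section \<open>Subrings of a field and their ideals\<close>

lemma domain_in_iff:
  "domain_in (R :: 'a::field set) \<longleftrightarrow>
     1 \<in> R \<and> (\<forall>x\<in>R. - x \<in> R) \<and> (\<forall>x\<in>R. \<forall>y\<in>R. x + y \<in> R) \<and> (\<forall>x\<in>R. \<forall>y\<in>R. x * y \<in> R)"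
    (is "_ \<longleftrightarrow> ?P")
proof
  interpret F: field "ring_of_type_algebra :: 'a ring"
    by (rule field_from_type_algebra)
  have neg: "\<ominus>\<^bsub>ring_of_type_algebra\<^esub> x = - x" for x :: 'a
    by (rule F.minus_equality) (auto simp: ring_of_type_algebra_def)
  show ?P if "domain_in R"
    using subdomainE[OF that[unfolded domain_in_def]] neg
    by (auto simp: ring_of_type_algebra_def)
  show "domain_in R" if ?P
    unfolding domain_in_def
    by (intro F.subdomainI' F.subringI, unfold neg)
       (use that in \<open>auto simp: ring_of_type_algebra_def\<close>)
qed

lemma domain_inD:
  assumes "domain_in R"
  shows "0 \<in> R" "1 \<in> R" "x \<in> R \<Longrightarrow> - x \<in> R" "x \<in> R \<Longrightarrow> y \<in> R \<Longrightarrow> x + y \<in> R"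
    "x \<in> R \<Longrightarrow> y \<in> R \<Longrightarrow> x - y \<in> R" "x \<in> R \<Longrightarrow> y \<in> R \<Longrightarrow> x * y \<in> R"
proof -
  show *: "1 \<in> R" "x \<in> R \<Longrightarrow> - x \<in> R" "x \<in> R \<Longrightarrow> y \<in> R \<Longrightarrow> x + y \<in> R"
    "x \<in> R \<Longrightarrow> y \<in> R \<Longrightarrow> x * y \<in> R" for x y
    using assms by (auto simp: domain_in_iff)
  show "0 \<in> R" using *(3)[of 1 "- 1"] * by auto
  show "x \<in> R \<Longrightarrow> y \<in> R \<Longrightarrow> x - y \<in> R"
    using *(3)[of x "- y"] * by auto
qed

lemma ring_on_simps [simp]:
  "carrier (ring_on R) = R" "x \<oplus>\<^bsub>ring_on R\<^esub> y = x + y" "x \<otimes>\<^bsub>ring_on R\<^esub> y = x * y"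
  "\<zero>\<^bsub>ring_on R\<^esub> = 0" "\<one>\<^bsub>ring_on R\<^esub> = 1"
  by (auto simp: ring_on_def ring_of_type_algebra_def)

lemma cring_ring_on:
  assumes "domain_in R"
  shows "cring (ring_on R)"
proof (intro cringI abelian_groupI comm_monoidI)
  show "\<exists>y\<in>carrier (ring_on R). y \<oplus>\<^bsub>ring_on R\<^esub> x = \<zero>\<^bsub>ring_on R\<^esub>" if "x \<in> carrier (ring_on R)" for x
    using that domain_inD[OF assms] by (intro bexI[of _ "- x"]) auto
qed (auto simp: algebra_simps domain_inD[OF assms])

lemma ideal_ring_on_iff:
  assumes "domain_in R"
  shows "ideal I (ring_on R) \<longleftrightarrow>
    I \<subseteq> R \<and> 0 \<in> I \<and> (\<forall>x\<in>I. \<forall>y\<in>I. x + y \<in> I) \<and> (\<forall>r\<in>R. \<forall>x\<in>I. r * x \<in> I)" (is "_ \<longleftrightarrow> ?P")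
proof
  interpret R: cring "ring_on R" by (rule cring_ring_on[OF assms])
  show ?P if "ideal I (ring_on R)"
  proof -
    interpret ideal I "ring_on R" by fact
    show ?P
      using a_subset additive_subgroup.zero_closed[OF is_additive_subgroup] a_closed I_l_closed
      by auto
  qed
  show "ideal I (ring_on R)" if P: ?P
  proof (rule idealI)
    have neg: "\<ominus>\<^bsub>ring_on R\<^esub> x = - x" if "x \<in> R" for x
      using that domain_inD(3)[OF assms] by (intro R.minus_equality) auto
    have "- x \<in> I" if "x \<in> I" for x
      using P that domain_inD(2,3)[OF assms] by (metis mult_minus1)
    then have "- x \<in> I \<and> \<ominus>\<^bsub>ring_on R\<^esub> x = - x" if "x \<in> I" for x
      using neg P that by auto
    then show "subgroup I (add_monoid (ring_on R))"
      using P by (intro R.add.subgroupI) (auto simp: a_inv_def)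
  next
    show "x \<otimes>\<^bsub>ring_on R\<^esub> a \<in> I" "a \<otimes>\<^bsub>ring_on R\<^esub> x \<in> I"
      if "a \<in> I" "x \<in> carrier (ring_on R)" for a x
      using that P by (auto simp: mult.commute[of a])
  qed (rule R.ring_axioms)
qed

lemma subset_quotient_field: "domain_in R \<Longrightarrow> R \<subseteq> quotient_field R"
  using domain_inD(2) unfolding quotient_field_def by (metis (mono_tags, lifting) div_by_1 mem_Collect_eq subsetI zero_neq_one)

lemma quotient_field_mono: "R \<subseteq> S \<Longrightarrow> quotient_field R \<subseteq> quotient_field S"
  by (auto simp: quotient_field_def)

lemma domain_in_quotient_field:
  assumes "domain_in R"
  shows "domain_in (quotient_field R)"
proof -
  note R = domain_inD[OF assms]
  have add: "a / b + c / d \<in> quotient_field R"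
    if "a \<in> R" "b \<in> R" "c \<in> R" "d \<in> R" "b \<noteq> 0" "d \<noteq> 0" for a b c d
  proof -
    have "a / b + c / d = (a * d + c * b) / (b * d)"
      using that by (simp add: add_frac_eq)
    moreover have "a * d + c * b \<in> R" "b * d \<in> R" "b * d \<noteq> 0"
      using that R by auto
    ultimately show ?thesis unfolding quotient_field_def by blast
  qed
  have mult: "(a / b) * (c / d) \<in> quotient_field R"
    if "a \<in> R" "b \<in> R" "c \<in> R" "d \<in> R" "b \<noteq> 0" "d \<noteq> 0" for a b c d
  proof -
    have "(a / b) * (c / d) = (a * c) / (b * d)" by simp
    moreover have "a * c \<in> R" "b * d \<in> R" "b * d \<noteq> 0"
      using that R by auto
    ultimately show ?thesis unfolding quotient_field_def by blast
  qed
  have neg: "- (a / b) \<in> quotient_field R" if "a \<in> R" "b \<in> R" "b \<noteq> 0" for a b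
  proof -
    have "- (a / b) = (- a) / b" by simp
    then show ?thesis using that R(3) unfolding quotient_field_def by blast
  qed
  have "1 \<in> quotient_field R"
    using subset_quotient_field[OF assms] R by auto
  moreover have "- x \<in> quotient_field R" if "x \<in> quotient_field R" for x
    using that neg by (auto simp: quotient_field_def[of R])
  moreover have "x + y \<in> quotient_field R" if "x \<in> quotient_field R" "y \<in> quotient_field R" for x y
  proof -
    obtain a b where "x = a / b" "a \<in> R" "b \<in> R" "b \<noteq> 0"
      using \<open>x \<in> quotient_field R\<close> by (auto simp: quotient_field_def)
    moreover obtain c d where "y = c / d" "c \<in> R" "d \<in> R" "d \<noteq> 0"
      using \<open>y \<in> quotient_field R\<close> by (auto simp: quotient_field_def)
    ultimately show ?thesis using add by auto
  qed
  moreover have "x * y \<in> quotient_field R" if "x \<in> quotient_field R" "y \<in> quotient_field R" for x y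
  proof -
    obtain a b where "x = a / b" "a \<in> R" "b \<in> R" "b \<noteq> 0"
      using \<open>x \<in> quotient_field R\<close> by (auto simp: quotient_field_def)
    moreover obtain c d where "y = c / d" "c \<in> R" "d \<in> R" "d \<noteq> 0"
      using \<open>y \<in> quotient_field R\<close> by (auto simp: quotient_field_def)
    ultimately show ?thesis using mult by metis
  qed
  ultimately show ?thesis by (auto simp: domain_in_iff)
qed

lemma subset_localization:
  assumes "domain_in D" and "maximalideal M (ring_on D)"
  shows "D \<subseteq> localization D M"
proof -
  interpret maximalideal M "ring_on D" by fact
  have "1 \<notin> M" using I_notcarr one_imp_carrier by auto
  then show ?thesis
    using domain_inD(2)[OF assms(1)] unfolding localization_def
    by (metis (mono_tags, lifting) DiffI div_by_1 mem_Collect_eq subsetI)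
qed


section \<open>Closure under the v-operation\<close>

lemma ideal_inverse_antimono: "I \<subseteq> J \<Longrightarrow> ideal_inverse R J \<subseteq> ideal_inverse R I"
  by (auto simp: ideal_inverse_def)

lemma v_closure_mono: "I \<subseteq> J \<Longrightarrow> v_closure R I \<subseteq> v_closure R J"
  unfolding v_closure_def by (intro ideal_inverse_antimono)

lemma subset_v_closure: "I \<subseteq> quotient_field R \<Longrightarrow> I \<subseteq> v_closure R I"
  by (auto simp: v_closure_def ideal_inverse_def mult.commute)

lemma v_closure_idem:
  assumes "I \<subseteq> quotient_field R"
  shows "v_closure R (v_closure R I) = v_closure R I"
proof
  have "v_closure R I \<subseteq> quotient_field R"
    by (auto simp: v_closure_def ideal_inverse_def)
  then show "v_closure R I \<subseteq> v_closure R (v_closure R I)"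
    by (rule subset_v_closure)
  have "ideal_inverse R I \<subseteq> ideal_inverse R (v_closure R I)"
    by (auto simp: v_closure_def ideal_inverse_def mult.commute)
  then show "v_closure R (v_closure R I) \<subseteq> v_closure R I"
    using ideal_inverse_antimono unfolding v_closure_def by blast
qed

text \<open>
  The set \<open>S\<close> need not be an ideal: \<open>v_closure R S\<close> equals \<open>(S R)\<^sub>v\<close>, because \<open>S\<close> and the ideal
  generated by \<open>S\<close> have the same inverse.
\<close>

lemma v_ideal_v_closure:
  assumes "domain_in R" "S \<subseteq> R" "\<exists>s\<in>S. s \<noteq> 0"
  shows "v_ideal R (v_closure R S)"
proof -
  note R = domain_inD[OF assms(1)]
  note Q = domain_inD[OF domain_in_quotient_field[OF assms(1)]]
  have sub: "S \<subseteq> quotient_field R"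
    using assms subset_quotient_field by blast
  have one: "1 \<in> ideal_inverse R S"
    using assms(2) Q(2) by (auto simp: ideal_inverse_def)
  have "v_closure R S \<subseteq> R"
    using one by (fastforce simp: v_closure_def ideal_inverse_def[of R "ideal_inverse R S"])
  moreover have "r * x \<in> v_closure R S" if "r \<in> R" "x \<in> v_closure R S" for r x
    using that R(6) Q(6) subset_quotient_field[OF assms(1)]
    by (auto simp: v_closure_def ideal_inverse_def[of R "ideal_inverse R S"] mult.assoc)
  moreover have "x + y \<in> v_closure R S" if "x \<in> v_closure R S" "y \<in> v_closure R S" for x y
    using that R(4) Q(4)
    by (auto simp: v_closure_def ideal_inverse_def[of R "ideal_inverse R S"] distrib_right)
  moreover have "0 \<in> v_closure R S"
    using R(1) Q(1) by (auto simp: v_closure_def ideal_inverse_def[of R "ideal_inverse R S"])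
  ultimately have "ideal (v_closure R S) (ring_on R)"
    by (simp add: ideal_ring_on_iff[OF assms(1)])
  moreover have "v_closure R S \<noteq> {0}"
    using subset_v_closure[OF sub] assms(3) by blast
  ultimately show ?thesis
    using v_closure_idem[OF sub] by (simp add: v_ideal_def)
qed


section \<open>Normalising a discrete valuation\<close>

text \<open>
  The values of a nontrivial homomorphism from the multiplicative group of a field to the integers form a
  subgroup, so they are multiples of a single one; dividing by it makes the homomorphism
  surjective without changing the signs of its values.
\<close>

lemma valuation_normalise:
  fixes w :: "'a::field \<Rightarrow> int"
  assumes mult: "\<And>x y. x \<noteq> 0 \<Longrightarrow> y \<noteq> 0 \<Longrightarrow> w (x * y) = w x + w y"
    and add: "\<And>x y. x \<noteq> 0 \<Longrightarrow> y \<noteq> 0 \<Longrightarrow> x + y \<noteq> 0 \<Longrightarrow> min (w x) (w y) \<le> w (x + y)"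
    and nontrivial: "\<exists>x. x \<noteq> 0 \<and> w x \<noteq> 0"
  obtains w' where "discrete_valuation_on UNIV w'"
    and "\<And>x. x \<noteq> 0 \<Longrightarrow> 0 \<le> w' x \<longleftrightarrow> 0 \<le> w x"
    and "\<And>x. x \<noteq> 0 \<Longrightarrow> w' x = 0 \<longleftrightarrow> w x = 0"
proof -
  have one: "w 1 = 0" using mult[of 1 1] by simp
  have inv: "w (inverse x) = - w x" if "x \<noteq> 0" for x
    using mult[of x "inverse x"] that one by simp
  have pow: "w (x ^ n) = int n * w x" if "x \<noteq> 0" for x n
    by (induction n) (use that one mult in \<open>auto simp: algebra_simps\<close>)
  have powi: "w (x powi k) = k * w x" if "x \<noteq> 0" for x k
    using that pow inv by (auto simp: power_int_def)
  have ex: "\<exists>n. 0 < n \<and> (\<exists>x. x \<noteq> 0 \<and> w x = int n)"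
  proof -
    obtain x where x: "x \<noteq> 0" "w x \<noteq> 0" using nontrivial by blast
    show ?thesis
    proof (cases "0 < w x")
      case True
      then show ?thesis using x by (intro exI[of _ "nat (w x)"]) auto
    next
      case False
      then show ?thesis using x inv[of x]
        by (intro exI[of _ "nat (- w x)"] conjI exI[of _ "inverse x"]) auto
    qed
  qed
  \<comment> \<open>the least positive value generates the value group\<close>
  define d where "d = (LEAST n. 0 < n \<and> (\<exists>x. x \<noteq> 0 \<and> w x = int n))"
  obtain t where d: "0 < d" "t \<noteq> 0" "w t = int d"
    using LeastI_ex[OF ex] unfolding d_def by blast
  have dvd: "int d dvd w x" if x: "x \<noteq> 0" for x
  proof (rule ccontr)
    assume "\<not> int d dvd w x"
    define r where "r = w x mod int d"
    have r: "0 < r" "r < int d"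
      using \<open>\<not> int d dvd w x\<close> d(1) pos_mod_bound[of "int d" "w x"] pos_mod_sign[of "int d" "w x"]
      unfolding r_def dvd_eq_mod_eq_0 by linarith+
    have "w (x * t powi (- (w x div int d))) = r"
      using x d powi mult by (simp add: r_def minus_div_mult_eq_mod [symmetric])
    then have "0 < nat r \<and> (\<exists>y. y \<noteq> 0 \<and> w y = int (nat r))"
      using r x d by (intro conjI exI[of _ "x * t powi (- (w x div int d))"]) auto
    then have "d \<le> nat r" unfolding d_def by (rule Least_le)
    then show False using r by simp
  qed
  define w' where "w' = (\<lambda>x. w x div int d)"
  have w': "w x = int d * w' x" if "x \<noteq> 0" for x
    using dvd[OF that] by (simp add: w'_def)
  have "k \<in> w' ` (UNIV - {0})" for k
    using d powi[of t k] by (intro image_eqI[of _ _ "t powi k"]) (auto simp: w'_def)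
  then have "w' ` (UNIV - {0}) = UNIV" by blast
  moreover have "w' (x * y) = w' x + w' y" if "x \<noteq> 0" "y \<noteq> 0" for x y
    using mult[OF that] dvd[of x] dvd[of y] that by (simp add: w'_def)
  moreover have "min (w' x) (w' y) \<le> w' (x + y)" if "x \<noteq> 0" "y \<noteq> 0" "x + y \<noteq> 0" for x y
    using add[OF that] zdiv_mono1[of "w x" "w (x + y)" "int d"]
      zdiv_mono1[of "w y" "w (x + y)" "int d"] d(1)
    by (auto simp: w'_def min_le_iff_disj)
  ultimately have "discrete_valuation_on UNIV w'"
    by (auto simp: discrete_valuation_on_def)
  then show ?thesis
    using that[of w'] w' d(1) by (auto simp: zero_le_mult_iff)
qed


section \<open>Descent along a field embedding\<close>

text \<open>
  A homomorphism of fields, hence injective. The domains to be compared are a subring \<open>R\<close> of the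
  target and its preimage \<open>\<iota> -` R\<close>, which plays the role of \<open>R \<inter> K\<close> with \<open>K\<close> the source field.
\<close>

locale field_embedding =
  fixes \<iota> :: "'a::field \<Rightarrow> 'b::field"
  assumes hom_add: "\<iota> (x + y) = \<iota> x + \<iota> y"
    and hom_mult: "\<iota> (x * y) = \<iota> x * \<iota> y"
    and hom_one: "\<iota> 1 = 1"
begin

lemma hom_zero [simp]: "\<iota> 0 = 0"
  using hom_add[of 0 0] by (metis add_0_right add_left_cancel)

lemma hom_uminus: "\<iota> (- x) = - \<iota> x"
  using hom_add[of x "- x"] by (simp add: eq_neg_iff_add_eq_0 add.commute)

lemma hom_eq_0_iff [simp]: "\<iota> x = 0 \<longleftrightarrow> x = 0"
  using hom_mult[of x "inverse x"] hom_one by (cases "x = 0") auto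

lemma hom_divide: "\<iota> (x / y) = \<iota> x / \<iota> y"
proof (cases "y = 0")
  case False
  then have "\<iota> (x / y) * \<iota> y = \<iota> x" by (simp flip: hom_mult)
  then show ?thesis using False by (simp add: field_simps)
qed simp

lemma domain_in_vimage: "domain_in R \<Longrightarrow> domain_in (\<iota> -` R)"
  by (auto simp: domain_in_iff hom_add hom_mult hom_one hom_uminus)

lemma hom_quotient_field:
  assumes "quotient_field (\<iota> -` R) = UNIV"
  shows "\<iota> x \<in> quotient_field R"
proof -
  have "x \<in> quotient_field (\<iota> -` R)" using assms by simp
  then obtain a b where "x = a / b" "\<iota> a \<in> R" "\<iota> b \<in> R" "b \<noteq> 0"
    by (auto simp: quotient_field_def)
  then have "\<iota> x = \<iota> a / \<iota> b" "\<iota> b \<noteq> 0" by (simp_all add: hom_divide)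
  then show ?thesis
    using \<open>\<iota> a \<in> R\<close> \<open>\<iota> b \<in> R\<close> unfolding quotient_field_def by blast
qed

lemma krull_vimage:
  assumes "krull R" and Q: "quotient_field (\<iota> -` R) = UNIV"
  shows "krull (\<iota> -` R)"
proof -
  obtain V where dv: "\<forall>v\<in>V. discrete_valuation_on (quotient_field R) v"
    and R: "R = {x \<in> quotient_field R. \<forall>v\<in>V. x \<in> valuation_ring_on (quotient_field R) v}"
    and fin: "\<forall>x\<in>quotient_field R - {0}. finite {v \<in> V. v x \<noteq> 0}"
    using assms(1) unfolding krull_def by blast
  have emb: "\<iota> x \<in> quotient_field R" for x by (rule hom_quotient_field[OF Q])
  have memb: "\<iota> x \<in> R \<longleftrightarrow> (\<forall>v\<in>V. x = 0 \<or> 0 \<le> v (\<iota> x))" for x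
    by (subst R) (auto simp: valuation_ring_on_def emb)
  define V0 where "V0 = {v \<in> V. \<exists>x. x \<noteq> 0 \<and> v (\<iota> x) \<noteq> 0}"
  have "\<exists>w. discrete_valuation_on UNIV w \<and>
      (\<forall>x. x \<noteq> 0 \<longrightarrow> (0 \<le> w x \<longleftrightarrow> 0 \<le> v (\<iota> x)) \<and> (w x = 0 \<longleftrightarrow> v (\<iota> x) = 0))"
    if "v \<in> V0" for v
  proof -
    have v: "discrete_valuation_on (quotient_field R) v" "\<exists>x. x \<noteq> 0 \<and> v (\<iota> x) \<noteq> 0"
      using that dv by (auto simp: V0_def)
    have "v (\<iota> (x * y)) = v (\<iota> x) + v (\<iota> y)" if "x \<noteq> 0" "y \<noteq> 0" for x y
      using v(1) that emb by (simp add: discrete_valuation_on_def hom_mult)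
    moreover have "min (v (\<iota> x)) (v (\<iota> y)) \<le> v (\<iota> (x + y))"
      if "x \<noteq> 0" "y \<noteq> 0" "x + y \<noteq> 0" for x y
    proof -
      have "\<iota> x + \<iota> y \<noteq> 0" using that(3) by (simp flip: hom_add)
      then show ?thesis
        using v(1) that emb by (simp add: discrete_valuation_on_def hom_add)
    qed
    ultimately obtain w where "discrete_valuation_on UNIV w"
      "\<And>x. x \<noteq> 0 \<Longrightarrow> 0 \<le> w x \<longleftrightarrow> 0 \<le> v (\<iota> x)"
      "\<And>x. x \<noteq> 0 \<Longrightarrow> w x = 0 \<longleftrightarrow> v (\<iota> x) = 0"
      using valuation_normalise[of "\<lambda>x. v (\<iota> x)"] v(2) by blast
    then show ?thesis by blast
  qed
  then obtain n where n: "\<And>v. v \<in> V0 \<Longrightarrow> discrete_valuation_on UNIV (n v)"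
    and n_nonneg: "\<And>v x. v \<in> V0 \<Longrightarrow> x \<noteq> 0 \<Longrightarrow> 0 \<le> n v x \<longleftrightarrow> 0 \<le> v (\<iota> x)"
    and n_zero: "\<And>v x. v \<in> V0 \<Longrightarrow> x \<noteq> 0 \<Longrightarrow> n v x = 0 \<longleftrightarrow> v (\<iota> x) = 0"
    by metis
  have "\<iota> x \<in> R \<longleftrightarrow> (\<forall>w\<in>n ` V0. x \<in> valuation_ring_on UNIV w)" for x
  proof -
    have "\<iota> x \<in> R \<longleftrightarrow> (\<forall>v\<in>V0. x = 0 \<or> 0 \<le> v (\<iota> x))"
      unfolding memb V0_def by force
    then show ?thesis
      using n_nonneg by (auto simp: valuation_ring_on_def)
  qed
  then have "\<iota> -` R = {x \<in> UNIV. \<forall>w\<in>n ` V0. x \<in> valuation_ring_on UNIV w}"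
    by auto
  moreover have "finite {w \<in> n ` V0. w x \<noteq> 0}" if "x \<noteq> 0" for x
  proof (rule finite_subset)
    show "{w \<in> n ` V0. w x \<noteq> 0} \<subseteq> n ` {v \<in> V. v (\<iota> x) \<noteq> 0}"
      using n_zero that by (auto simp: V0_def)
    show "finite (n ` {v \<in> V. v (\<iota> x) \<noteq> 0})"
      using fin emb that by simp
  qed
  moreover have "domain_in (\<iota> -` R)"
    using assms(1) by (intro domain_in_vimage) (simp add: krull_def)
  ultimately show ?thesis
    unfolding krull_def Q using n by (intro conjI exI[of _ "n ` V0"]) auto
qed

text \<open>
  A divisorial ideal \<open>I\<close> of \<open>R \<inter> K\<close> is the contraction of \<open>(I R)\<^sub>v\<close>: the inverse of \<open>I\<close> embeds
  into that of \<open>I R\<close>, so every \<open>x\<close> in the contraction multiplies the inverse of \<open>I\<close> into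
  \<open>R \<inter> K\<close>, which means that \<open>x \<in> I\<^sub>v = I\<close>.
\<close>

lemma v_ideal_contraction:
  assumes Q: "quotient_field (\<iota> -` R) = UNIV" and "v_ideal (\<iota> -` R) I"
  shows "\<iota> -` v_closure R (\<iota> ` I) = I"
proof
  have emb: "\<iota> x \<in> quotient_field R" for x by (rule hom_quotient_field[OF Q])
  then show "I \<subseteq> \<iota> -` v_closure R (\<iota> ` I)"
    using subset_v_closure[of "\<iota> ` I" R] by blast
  show "\<iota> -` v_closure R (\<iota> ` I) \<subseteq> I"
  proof
    fix x assume x: "x \<in> \<iota> -` v_closure R (\<iota> ` I)"
    have "\<iota> (x * y) \<in> R" if "y \<in> ideal_inverse (\<iota> -` R) I" for y
    proof -
      have "\<iota> y \<in> ideal_inverse R (\<iota> ` I)"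
        using that emb by (auto simp: ideal_inverse_def hom_mult)
      then show ?thesis
        using x by (auto simp: v_closure_def ideal_inverse_def[of R "ideal_inverse R _"] hom_mult)
    qed
    then have "x \<in> v_closure (\<iota> -` R) I"
      by (simp add: v_closure_def ideal_inverse_def[of _ "ideal_inverse _ _"] Q)
    then show "x \<in> I" using assms(2) by (simp add: v_ideal_def)
  qed
qed

lemma mori_vimage:
  assumes "mori R" and Q: "quotient_field (\<iota> -` R) = UNIV"
  shows "mori (\<iota> -` R)"
  unfolding mori_def
proof (intro conjI allI impI)
  have dom: "domain_in R" using assms(1) by (simp add: mori_def)
  show dom': "domain_in (\<iota> -` R)" using dom by (rule domain_in_vimage)
  fix I :: "nat \<Rightarrow> 'a set"
  assume I: "(\<forall>n. v_ideal (\<iota> -` R) (I n)) \<and> (\<forall>n. I n \<subseteq> I (Suc n))"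
  define J where "J n = v_closure R (\<iota> ` I n)" for n
  have "v_ideal R (J n)" for n
  proof -
    have "ideal (I n) (ring_on (\<iota> -` R))" "I n \<noteq> {0}"
      using I by (auto simp: v_ideal_def)
    then have "I n \<subseteq> \<iota> -` R" "\<exists>s\<in>I n. s \<noteq> 0"
      by (auto simp: ideal_ring_on_iff[OF dom'])
    then show ?thesis
      unfolding J_def by (intro v_ideal_v_closure[OF dom]) auto
  qed
  moreover have "J n \<subseteq> J (Suc n)" for n
    unfolding J_def using I by (intro v_closure_mono image_mono) auto
  ultimately obtain N where "\<forall>n\<ge>N. J n = J N"
    using assms(1) unfolding mori_def by blast
  moreover have "I n = \<iota> -` J n" for n
    using v_ideal_contraction[OF Q] I by (simp add: J_def)
  ultimately show "\<exists>N. \<forall>n\<ge>N. I n = I N" by metis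
qed


section \<open>Localizations along a retraction\<close>

text \<open>
  Here \<open>\<phi>\<close> is a ring homomorphism from \<open>R\<close> onto \<open>D\<close> that is left inverse to \<open>\<iota>\<close> on \<open>D\<close>; its
  values outside \<open>R\<close> are arbitrary.
\<close>

context
  fixes R :: "'b set" and D M :: "'a set" and \<phi> :: "'b \<Rightarrow> 'a"
  assumes R: "domain_in R" and D: "domain_in D" and QD: "quotient_field D = UNIV"
    and M: "maximalideal M (ring_on D)"
    and emb: "\<And>d. d \<in> D \<Longrightarrow> \<iota> d \<in> R"
    and retr_in: "\<And>f. f \<in> R \<Longrightarrow> \<phi> f \<in> D"
    and retr_add: "\<And>f g. f \<in> R \<Longrightarrow> g \<in> R \<Longrightarrow> \<phi> (f + g) = \<phi> f + \<phi> g"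
    and retr_mult: "\<And>f g. f \<in> R \<Longrightarrow> g \<in> R \<Longrightarrow> \<phi> (f * g) = \<phi> f * \<phi> g"
    and retr: "\<And>d. d \<in> D \<Longrightarrow> \<phi> (\<iota> d) = d"
begin

text \<open>
  An ideal \<open>J\<close> of \<open>R\<close> containing the preimage of \<open>M\<close> has an image \<open>\<phi> ` J\<close> that is an ideal of \<open>D\<close>
  containing \<open>M\<close>, so the maximality of \<open>M\<close> decides between the two cases.
\<close>

lemma maximalideal_retraction: "maximalideal {f \<in> R. \<phi> f \<in> M} (ring_on R)" (is "maximalideal ?N _")
proof (rule maximalidealI)
  interpret M: maximalideal M "ring_on D" by (rule M)
  have M_iff: "M \<subseteq> D" "0 \<in> M" "\<And>x y. x \<in> M \<Longrightarrow> y \<in> M \<Longrightarrow> x + y \<in> M"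
      "\<And>r x. r \<in> D \<Longrightarrow> x \<in> M \<Longrightarrow> r * x \<in> M"
    using M.ideal_axioms by (auto simp: ideal_ring_on_iff[OF D])
  have M1: "1 \<notin> M" using M.I_notcarr M.one_imp_carrier by auto
  have zero: "\<phi> 0 = 0" using retr[of 0] domain_inD(1)[OF D] by simp
  have one: "\<phi> 1 = 1" using retr[of 1] domain_inD(2)[OF D] hom_one by simp
  show "ideal ?N (ring_on R)"
    using domain_inD[OF R] M_iff zero
    by (auto simp: ideal_ring_on_iff[OF R] retr_in retr_add retr_mult)
  show "carrier (ring_on R) \<noteq> ?N"
    using M1 one domain_inD(2)[OF R] by (metis (mono_tags, lifting) mem_Collect_eq ring_on_simps(1))
  fix J assume J: "ideal J (ring_on R)" "?N \<subseteq> J" "J \<subseteq> carrier (ring_on R)"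
  have J_iff: "J \<subseteq> R" "0 \<in> J" "\<And>x y. x \<in> J \<Longrightarrow> y \<in> J \<Longrightarrow> x + y \<in> J"
      "\<And>r x. r \<in> R \<Longrightarrow> x \<in> J \<Longrightarrow> r * x \<in> J"
    using J(1) by (auto simp: ideal_ring_on_iff[OF R])
  have "r * x \<in> \<phi> ` J" if "r \<in> D" "x \<in> \<phi> ` J" for r x
  proof -
    obtain f where f: "f \<in> J" "x = \<phi> f" using \<open>x \<in> \<phi> ` J\<close> by blast
    then have "\<phi> (\<iota> r * f) = r * x"
      using J_iff(1) \<open>r \<in> D\<close> by (auto simp: retr_mult retr emb)
    then show ?thesis using J_iff(4)[OF emb[OF \<open>r \<in> D\<close>] f(1)] by (metis imageI)
  qed
  moreover have "x + y \<in> \<phi> ` J" if "x \<in> \<phi> ` J" "y \<in> \<phi> ` J" for x y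
  proof -
    obtain f g where f: "f \<in> J" "x = \<phi> f" "g \<in> J" "y = \<phi> g"
      using \<open>x \<in> \<phi> ` J\<close> \<open>y \<in> \<phi> ` J\<close> by blast
    then have "\<phi> (f + g) = x + y" using J_iff(1) retr_add[of f g] by auto
    then show ?thesis using J_iff(3)[OF f(1,3)] by (metis imageI)
  qed
  moreover have "0 \<in> \<phi> ` J" using J_iff(2) zero by force
  moreover have sub: "\<phi> ` J \<subseteq> D" using J_iff(1) retr_in by blast
  ultimately have "ideal (\<phi> ` J) (ring_on D)" by (simp add: ideal_ring_on_iff[OF D])
  moreover have "M \<subseteq> \<phi> ` J"
  proof
    fix m assume m: "m \<in> M"
    then have "m \<in> D" using M_iff(1) by blast
    then have "\<iota> m \<in> ?N" using m by (simp add: emb retr)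
    then show "m \<in> \<phi> ` J" using J(2) retr[OF \<open>m \<in> D\<close>] by (metis image_eqI subsetD)
  qed
  ultimately consider "\<phi> ` J = M" | "\<phi> ` J = D"
    using M.I_maximal[of "\<phi> ` J"] sub by auto
  then show "J = ?N \<or> J = carrier (ring_on R)"
  proof cases
    case 1
    then show ?thesis using J by auto
  next
    case 2
    then obtain f where f: "f \<in> J" "\<phi> f = 1" using domain_inD(2)[OF D] by (metis imageE)
    then have fR: "f \<in> R" using J_iff(1) by blast
    have "- 1 \<in> D" using domain_inD[OF D] by blast
    have "- 1 \<in> R" using domain_inD[OF R] by blast
    \<comment> \<open>\<open>1 - f\<close> lies in the kernel of the retraction, hence in \<open>J\<close>\<close>
    have "\<phi> (1 + (- 1) * f) = 0"
      using fR f(2) one retr[OF \<open>- 1 \<in> D\<close>] \<open>- 1 \<in> R\<close> domain_inD[OF R]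
      by (simp only: retr_add retr_mult hom_uminus hom_one) simp
    then have "1 + (- 1) * f \<in> J"
      using J(2) M_iff(2) fR domain_inD[OF R] by auto
    then have "1 \<in> J" using J_iff(3)[OF _ f(1)] by fastforce
    then show ?thesis using J_iff(1) J_iff(4)[of _ 1] by auto
  qed
qed

lemma localization_retraction: "\<iota> -` localization R {f \<in> R. \<phi> f \<in> M} = localization D M"
proof
  show "localization D M \<subseteq> \<iota> -` localization R {f \<in> R. \<phi> f \<in> M}"
  proof
    fix x assume "x \<in> localization D M"
    then obtain a b where ab: "x = a / b" "a \<in> D" "b \<in> D" "b \<notin> M"
      by (auto simp: localization_def)
    then have "\<iota> x = \<iota> a / \<iota> b" "\<iota> a \<in> R" "\<iota> b \<in> R - {f \<in> R. \<phi> f \<in> M}"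
      by (auto simp: hom_divide emb retr)
    then show "x \<in> \<iota> -` localization R {f \<in> R. \<phi> f \<in> M}"
      unfolding localization_def by blast
  qed
  show "\<iota> -` localization R {f \<in> R. \<phi> f \<in> M} \<subseteq> localization D M"
  proof
    fix x assume "x \<in> \<iota> -` localization R {f \<in> R. \<phi> f \<in> M}"
    then obtain f g where fg: "\<iota> x = f / g" "f \<in> R" "g \<in> R" "\<phi> g \<notin> M"
      by (auto simp: localization_def)
    interpret M: maximalideal M "ring_on D" by (rule M)
    have "0 \<in> M" using M.ideal_axioms by (simp add: ideal_ring_on_iff[OF D])
    then have g: "\<phi> g \<noteq> 0" using fg(4) by auto
    then have "g \<noteq> 0" using retr[of 0] domain_inD(1)[OF D] by auto
    have "x \<in> quotient_field D" using QD by simp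
    then obtain a b where ab: "x = a / b" "a \<in> D" "b \<in> D" "b \<noteq> 0"
      by (auto simp: quotient_field_def)
    \<comment> \<open>\<open>\<phi>\<close> need not be defined at \<open>\<iota> x\<close>, so denominators are cleared before applying it\<close>
    have "\<iota> a * g = f * \<iota> b"
      using fg(1) ab \<open>g \<noteq> 0\<close> by (simp add: hom_divide field_simps)
    then have "\<phi> (\<iota> a * g) = \<phi> (f * \<iota> b)" by simp
    then have "a * \<phi> g = \<phi> f * b"
      using ab fg by (simp add: retr_mult retr emb)
    then have "x = \<phi> f / \<phi> g" using ab g by (simp add: frac_eq_eq)
    then show "x \<in> localization D M"
      using fg retr_in unfolding localization_def by blast
  qed
qed

end

end


section \<open>Integer-valued rational functions\<close>

text \<open>
  The embedding of \<open>K\<close> into \<open>K(X)\<close> as the constant rational functions.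
\<close>

definition const_fract :: "'a::field \<Rightarrow> 'a poly fract" where
  "const_fract c = Fract [:c:] 1"

text \<open>
  The value at \<open>e\<close> of a rational function defined at \<open>e\<close>; at a pole the value is unspecified.
\<close>

definition fract_value :: "'a::field \<Rightarrow> 'a poly fract \<Rightarrow> 'a" where
  "fract_value e f = (THE y. \<exists>p q. f = Fract p q \<and> poly q e \<noteq> 0 \<and> y = poly p e / poly q e)"

lemma fract_value_Fract:
  assumes "poly q e \<noteq> 0"
  shows "fract_value e (Fract p q) = poly p e / poly q e"
  unfolding fract_value_def
proof (rule the_equality)
  fix y assume "\<exists>p' q'. Fract p q = Fract p' q' \<and> poly q' e \<noteq> 0 \<and> y = poly p' e / poly q' e"
  then obtain p' q' where *: "Fract p q = Fract p' q'" "poly q' e \<noteq> 0" "y = poly p' e / poly q' e"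
    by blast
  then have "p * q' = p' * q"
    using assms by (subst (asm) eq_fract) auto
  then have "poly p e * poly q' e = poly p' e * poly q e" by (metis poly_mult)
  then show "y = poly p e / poly q e"
    using * assms by (simp add: frac_eq_eq)
qed (use assms in auto)

lemma field_embedding_const_fract: "field_embedding (const_fract :: 'a::field \<Rightarrow> _)"
  by unfold_locales
    (auto simp: const_fract_def One_fract_def algebra_simps simp flip: one_pCons)

lemma int_rat_iff:
  "f \<in> int_rat E D \<longleftrightarrow>
    (\<forall>e\<in>E. (\<exists>p q. f = Fract p q \<and> poly q e \<noteq> 0) \<and> fract_value e f \<in> D)"
  unfolding int_rat_def by (auto simp: fract_value_Fract) (metis fract_value_Fract)+

lemma fract_value_const: "fract_value e (const_fract c) = c"
  by (simp add: const_fract_def fract_value_Fract)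

lemma const_fract_in_int_rat: "c \<in> D \<Longrightarrow> const_fract c \<in> int_rat E D"
  unfolding int_rat_iff fract_value_const by (metis const_fract_def poly_1 zero_neq_one)

lemma vimage_const_fract_int_rat: "E \<noteq> {} \<Longrightarrow> const_fract -` int_rat E D = D"
  using const_fract_in_int_rat[of _ D E] by (fastforce simp: int_rat_iff fract_value_const)

lemma
  assumes "\<exists>p q. f = Fract p q \<and> poly q e \<noteq> 0" "\<exists>p q. g = Fract p q \<and> poly q e \<noteq> 0"
  shows fract_value_add: "fract_value e (f + g) = fract_value e f + fract_value e g"
    and fract_value_mult: "fract_value e (f * g) = fract_value e f * fract_value e g"
    and defined_add: "\<exists>p q. f + g = Fract p q \<and> poly q e \<noteq> 0"
    and defined_mult: "\<exists>p q. f * g = Fract p q \<and> poly q e \<noteq> 0"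
proof -
  obtain p q p' q' where *: "f = Fract p q" "poly q e \<noteq> 0" "g = Fract p' q'" "poly q' e \<noteq> 0"
    using assms by blast
  then have "q \<noteq> 0" "q' \<noteq> 0" by auto
  then have sum: "f + g = Fract (p * q' + p' * q) (q * q')" and prod: "f * g = Fract (p * p') (q * q')"
    using * by auto
  have qq: "poly (q * q') e \<noteq> 0" using * by simp
  show "fract_value e (f + g) = fract_value e f + fract_value e g"
    using * unfolding sum fract_value_Fract[OF qq] by (simp add: fract_value_Fract field_simps)
  show "fract_value e (f * g) = fract_value e f * fract_value e g"
    using * unfolding prod fract_value_Fract[OF qq] by (simp add: fract_value_Fract)
  show "\<exists>p q. f + g = Fract p q \<and> poly q e \<noteq> 0" "\<exists>p q. f * g = Fract p q \<and> poly q e \<noteq> 0"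
    using sum prod qq by blast+
qed

lemma domain_in_int_rat:
  assumes "domain_in D"
  shows "domain_in (int_rat E D)"
proof -
  interpret field_embedding "const_fract :: 'a \<Rightarrow> _" by (rule field_embedding_const_fract)
  note D = domain_inD[OF assms]
  have "1 \<in> int_rat E D" "- 1 \<in> int_rat E D"
    using const_fract_in_int_rat[of _ D E] D(2,3) hom_one hom_uminus by metis+
  moreover have add: "f + g \<in> int_rat E D" if "f \<in> int_rat E D" "g \<in> int_rat E D" for f g
    using that D(4) by (auto simp: int_rat_iff fract_value_add defined_add)
  moreover have mult: "f * g \<in> int_rat E D" if "f \<in> int_rat E D" "g \<in> int_rat E D" for f g
    using that D(6) by (auto simp: int_rat_iff fract_value_mult defined_mult)
  moreover have "- f \<in> int_rat E D" if "f \<in> int_rat E D" for f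
    using mult[of "- 1" f] that \<open>- 1 \<in> int_rat E D\<close> by simp
  ultimately show ?thesis by (auto simp: domain_in_iff)
qed

theorem proposition3p4:
  fixes D E :: "'a::field set"
  assumes "domain_in D"
    and "quotient_field D = UNIV"
    and "E \<noteq> {}"
  shows "(krull (int_rat E D) \<longrightarrow> krull D) \<and>
         (mori (int_rat E D) \<longrightarrow> mori D) \<and>
         (almost_krull (int_rat E D) \<longrightarrow> almost_krull D) \<and>
         (locally_mori (int_rat E D) \<longrightarrow> locally_mori D)"
proof -
  interpret field_embedding "const_fract :: 'a \<Rightarrow> _" by (rule field_embedding_const_fract)
  let ?R = "int_rat E D"
  obtain e where e: "e \<in> E" using assms(3) by blast
  have "krull D" if "krull ?R"
    using krull_vimage[OF that] assms(2) vimage_const_fract_int_rat[OF assms(3)] by metis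
  moreover have "mori D" if "mori ?R"
    using mori_vimage[OF that] assms(2) vimage_const_fract_int_rat[OF assms(3)] by metis
  moreover have local: "\<exists>N. maximalideal N (ring_on ?R) \<and>
      const_fract -` localization ?R N = localization D M \<and> quotient_field (localization D M) = UNIV"
    if M: "maximalideal M (ring_on D)" for M
  proof (intro exI conjI)
    have val: "fract_value e f \<in> D"
      "g \<in> ?R \<Longrightarrow> fract_value e (f + g) = fract_value e f + fract_value e g"
      "g \<in> ?R \<Longrightarrow> fract_value e (f * g) = fract_value e f * fract_value e g"
      if "f \<in> ?R" for f g
      using that e by (auto simp: int_rat_iff intro!: fract_value_add fract_value_mult)
    note retraction = domain_in_int_rat[OF assms(1)] assms(1,2) M const_fract_in_int_rat val
    show "maximalideal {f \<in> ?R. fract_value e f \<in> M} (ring_on ?R)"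
      by (rule maximalideal_retraction[of ?R D]) (fact retraction | rule fract_value_const)+
    show "const_fract -` localization ?R {f \<in> ?R. fract_value e f \<in> M} = localization D M"
      by (rule localization_retraction[of ?R D]) (fact retraction | rule fract_value_const)+
    show "quotient_field (localization D M) = UNIV"
      using quotient_field_mono[OF subset_localization[OF assms(1) M]] assms(2) by auto
  qed
  moreover have "krull (localization D M)" if "almost_krull ?R" "maximalideal M (ring_on D)" for M
    using that krull_vimage local unfolding almost_krull_def by metis
  moreover have "mori (localization D M)" if "locally_mori ?R" "maximalideal M (ring_on D)" for M
    using that mori_vimage local
    unfolding locally_mori_def by metis
  ultimately show ?thesis
    using assms(1) by (auto simp: almost_krull_def locally_mori_def)
qed

end
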